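(* Let $L$ be a first-order language and let $\Gamma$ be a set of unary pp $L$-formulas. For every $L$-structure $M$ set $\mathfrak u(M)=\bigcap_{\gamma\in\Gamma}\gamma(M)$. Suppose that (a) $\Gamma$ is closed under conjunction; (b) for all $\phi,\gamma\in\Gamma$, the formula $\phi^\gamma$ belongs to $\Gamma$; (c) $\mathfrak u(M)$ is a substructure of $M$ for every $L$-structure $M$. If $N$ is an algebraically compact $L$-structure, then $U=\mathfrak u(N)$ is algebraically compact and $U=\mathfrak u(U)$.
   Context: A pp (positive primitive) formula is a formula $\phi(\bar x)=\exists\bar y\,\psi(\bar x,\bar y)$ where $\psi$ is a finite conjunction of atomic $L$-formulas; it is unary if $\bar x$ is a single variable. $\gamma(M)$ denotes the set of elements of $M$ satisfying $\gamma$. For a pp formula $\phi(\bar x)=\exists\bar y\,\psi(\bar x,\bar y)$, with $\psi$ a finite conjunction of atomic $L$-formulas, and a unary pp formula $\gamma$, $\phi^\gamma$ is the pp formula $\exists\bar y\,\big(\psi(\bar x,\bar y)\wedge\bigwedge_i\gamma(x_i)\wedge\bigwedge_j\gamma(y_j)\big)$, where $x_i$, $y_j$ run over the entries of $\bar x$, $\bar y$. Formulas are identified up to logical equivalence in the closure conditions on $\Gamma$. An $L$-structure $N$ is algebraically compact (= atomic compact = pure injective) if every set of atomic $L$-formulas with parameters from $N$ (in arbitrarily many variables) that is finitely satisfiable in $N$ is satisfiable in $N$. *)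

theory Defs
  imports Main
begin

record ('f, 'r) lang =
  funs :: "'f set"
  rels :: "'r set"
  fun_arity :: "'f \<Rightarrow> nat"
  rel_arity :: "'r \<Rightarrow> nat"

datatype (dead 'f, tm_vars: 'v) tm = Var 'v | Fun 'f "('f, 'v) tm list"
  for map: tm_rename

datatype (dead 'f, dead 'r, atom_vars: 'v) atom =
  Eq "('f, 'v) tm" "('f, 'v) tm" | Rel 'r "('f, 'v) tm list"
  for map: atom_rename

fun wf_tm :: "('f, 'r) lang \<Rightarrow> ('f, 'v) tm \<Rightarrow> bool" where
  "wf_tm L (Var v) \<longleftrightarrow> True"
| "wf_tm L (Fun f ts) \<longleftrightarrow>
     f \<in> funs L \<and> length ts = fun_arity L f \<and> (\<forall>t\<in>set ts. wf_tm L t)"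

fun wf_atom :: "('f, 'r) lang \<Rightarrow> ('f, 'r, 'v) atom \<Rightarrow> bool" where
  "wf_atom L (Eq s t) \<longleftrightarrow> wf_tm L s \<and> wf_tm L t"
| "wf_atom L (Rel r ts) \<longleftrightarrow>
     r \<in> rels L \<and> length ts = rel_arity L r \<and> (\<forall>t\<in>set ts. wf_tm L t)"

record ('f, 'r, 'a) struct =
  carrier :: "'a set"
  interp_fun :: "'f \<Rightarrow> 'a list \<Rightarrow> 'a"
  interp_rel :: "'r \<Rightarrow> 'a list \<Rightarrow> bool"

definition closed_under_funs :: "('f, 'r) lang \<Rightarrow> ('f, 'r, 'a) struct \<Rightarrow> 'a set \<Rightarrow> bool" where
  "closed_under_funs L M A \<longleftrightarrow>
     (\<forall>f\<in>funs L. \<forall>xs. length xs = fun_arity L f \<and> set xs \<subseteq> A \<longrightarrow> interp_fun M f xs \<in> A)"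

definition is_struct :: "('f, 'r) lang \<Rightarrow> ('f, 'r, 'a) struct \<Rightarrow> bool" where
  "is_struct L M \<longleftrightarrow> carrier M \<noteq> {} \<and> closed_under_funs L M (carrier M)"

definition is_substruct ::
  "('f, 'r) lang \<Rightarrow> 'a set \<Rightarrow> ('f, 'r, 'a) struct \<Rightarrow> bool" where
  "is_substruct L A M \<longleftrightarrow> A \<subseteq> carrier M \<and> A \<noteq> {} \<and> closed_under_funs L M A"

definition induced :: "('f, 'r, 'a) struct \<Rightarrow> 'a set \<Rightarrow> ('f, 'r, 'a) struct" where
  "induced M A = M\<lparr>carrier := A\<rparr>"

fun tm_val :: "('f, 'r, 'a) struct \<Rightarrow> ('v \<Rightarrow> 'a) \<Rightarrow> ('f, 'v) tm \<Rightarrow> 'a" where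
  "tm_val M e (Var v) = e v"
| "tm_val M e (Fun f ts) = interp_fun M f (map (tm_val M e) ts)"

fun sat_atom :: "('f, 'r, 'a) struct \<Rightarrow> ('v \<Rightarrow> 'a) \<Rightarrow> ('f, 'r, 'v) atom \<Rightarrow> bool" where
  "sat_atom M e (Eq s t) \<longleftrightarrow> tm_val M e s = tm_val M e t"
| "sat_atom M e (Rel r ts) \<longleftrightarrow> interp_rel M r (map (tm_val M e) ts)"

text \<open>
  \<open>PP k \<psi>\<close> is the unary pp formula \<open>\<exists>y\<^sub>1 \<dots> y\<^sub>k. \<And>\<psi>\<close>, where variable \<open>0\<close> is the free variable \<open>x\<close>
  and variable \<open>i\<close> with \<open>1 \<le> i \<le> k\<close> is \<open>y\<^sub>i\<close>.
\<close>

datatype ('f, 'r) pp = PP (nbound: nat) (matrix: "('f, 'r, nat) atom list")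

definition is_unary_pp :: "('f, 'r) lang \<Rightarrow> ('f, 'r) pp \<Rightarrow> bool" where
  "is_unary_pp L \<phi> \<longleftrightarrow> (\<forall>\<alpha>\<in>set (matrix \<phi>). wf_atom L \<alpha> \<and> atom_vars \<alpha> \<subseteq> {0..nbound \<phi>})"

definition pp_set :: "('f, 'r, 'a) struct \<Rightarrow> ('f, 'r) pp \<Rightarrow> 'a set" where
  "pp_set M \<phi> = {x \<in> carrier M. \<exists>ys. length ys = nbound \<phi> \<and> set ys \<subseteq> carrier M \<and>
      (\<forall>\<alpha>\<in>set (matrix \<phi>). sat_atom M (nth (x # ys)) \<alpha>)}"

text \<open>
  Conjunction, in prenex form: the bound variables of \<open>\<psi>\<close> are shifted past those of \<open>\<phi>\<close>.
\<close>

definition pp_conj :: "('f, 'r) pp \<Rightarrow> ('f, 'r) pp \<Rightarrow> ('f, 'r) pp" where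
  "pp_conj \<phi> \<psi> = PP (nbound \<phi> + nbound \<psi>)
     (matrix \<phi> @ map (atom_rename (\<lambda>j. if j = 0 then 0 else nbound \<phi> + j)) (matrix \<psi>))"

text \<open>
  The formula \<open>\<phi>\<^sup>\<gamma>\<close>, in prenex form. For each \<open>i \<in> {0, \<dots>, nbound \<phi>}\<close>, the conjunct
  \<open>\<gamma>(x)\<close> (for \<open>i = 0\<close>) or \<open>\<gamma>(y\<^sub>i)\<close> gets its own block of \<open>nbound \<gamma>\<close> fresh bound variables.
  The lemma \<open>pp_set_relativize\<close> below gives the meaning.
\<close>

definition relativize :: "('f, 'r) pp \<Rightarrow> ('f, 'r) pp \<Rightarrow> ('f, 'r) pp" where
  "relativize \<phi> \<gamma> = PP (nbound \<phi> + Suc (nbound \<phi>) * nbound \<gamma>)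
     (matrix \<phi> @
      concat (map (\<lambda>i. map (atom_rename (\<lambda>j. if j = 0 then i else nbound \<phi> + i * nbound \<gamma> + j))
                            (matrix \<gamma>))
                  [0..<Suc (nbound \<phi>)]))"

text \<open>Intersecting with the carrier only matters for \<open>\<Gamma> = {}\<close>.\<close>

definition pp_core :: "('f, 'r) pp set \<Rightarrow> ('f, 'r, 'a) struct \<Rightarrow> 'a set" where
  "pp_core \<Gamma> M = carrier M \<inter> (\<Inter>\<gamma>\<in>\<Gamma>. pp_set M \<gamma>)"

text \<open>
  HOL cannot quantify over all types inside a formula, so the type from which the elements of
  structures are drawn is a parameter. See \<open>elts\<close> below for the choice.
\<close>

definition logically_equivalent ::
  "'m itself \<Rightarrow> ('f, 'r) lang \<Rightarrow> ('f, 'r) pp \<Rightarrow> ('f, 'r) pp \<Rightarrow> bool" where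
  "logically_equivalent _ L \<phi> \<psi> \<longleftrightarrow>
     (\<forall>M :: ('f, 'r, 'm) struct. is_struct L M \<longrightarrow> pp_set M \<phi> = pp_set M \<psi>)"

text \<open>
  The cardinality of this type is at least \<open>|L| + \<aleph>\<^sub>0\<close>. By the downward Loewenheim-Skolem theorem,
  two pp formulas that are not equivalent are already distinguished by a structure with elements
  in this type; likewise, if \<open>pp_core \<Gamma> M\<close> fails to be a substructure of some structure \<open>M\<close> over
  any type, then it fails for one over this type. So quantifying over structures with elements
  in this type amounts to quantifying over all structures.
\<close>

type_synonym ('f, 'r, 'a) elts = "'a + ('f, 'r) pp"

text \<open>
  Atomic formulas with parameters in \<open>'a\<close> and variables in \<open>'v\<close> have variable type \<open>'v + 'a\<close>:
  \<open>Inl v\<close> is the variable \<open>v\<close>, \<open>Inr a\<close> is the parameter \<open>a\<close>.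
\<close>

definition satisfiable ::
  "('f, 'r, 'a) struct \<Rightarrow> ('f, 'r, 'v + 'a) atom set \<Rightarrow> bool" where
  "satisfiable N \<Phi> \<longleftrightarrow>
     (\<exists>e. range e \<subseteq> carrier N \<and> (\<forall>\<alpha>\<in>\<Phi>. sat_atom N (case_sum e id) \<alpha>))"

text \<open>Algebraic compactness with respect to systems whose variables are drawn from \<open>'v\<close>.\<close>

definition algebraically_compact ::
  "'v itself \<Rightarrow> ('f, 'r) lang \<Rightarrow> ('f, 'r, 'a) struct \<Rightarrow> bool" where
  "algebraically_compact _ L N \<longleftrightarrow> is_struct L N \<and>
     (\<forall>\<Phi> :: ('f, 'r, 'v + 'a) atom set.
        (\<forall>\<alpha>\<in>\<Phi>. wf_atom L \<alpha> \<and> atom_vars \<alpha> \<subseteq> range Inl \<union> Inr ` carrier N) \<longrightarrow>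
        (\<forall>\<Phi>\<^sub>0. \<Phi>\<^sub>0 \<subseteq> \<Phi> \<longrightarrow> finite \<Phi>\<^sub>0 \<longrightarrow> satisfiable N \<Phi>\<^sub>0) \<longrightarrow>
        satisfiable N \<Phi>)"

text \<open>
  The cardinality of this type is at least \<open>|'v| + |'a| + |L| + \<aleph>\<^sub>0\<close>. Algebraic compactness with
  respect to it is implied by (and in fact, since it is at least \<open>|L| + |N| + \<aleph>\<^sub>0\<close>, equivalent to)
  algebraic compactness with respect to arbitrary sets of variables. It serves to express
  that property as a hypothesis; as a conclusion it is expressed by
  \<open>algebraically_compact TYPE('v)\<close> with a free type variable \<open>'v\<close>.
\<close>

type_synonym ('f, 'r, 'a, 'v) many_vars = "('v + 'a) \<times> ('f, 'r) pp \<times> nat"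

subsection \<open>Meaning of the prenex forms\<close>

lemma tm_val_rename: "tm_val M e (tm_rename \<rho> t) = tm_val M (e \<circ> \<rho>) t"
  by (induction t) (auto cong: map_cong simp: comp_def)

lemma sat_atom_rename: "sat_atom M e (atom_rename \<rho> \<alpha>) \<longleftrightarrow> sat_atom M (e \<circ> \<rho>) \<alpha>"
  by (cases \<alpha>) (auto simp: tm_val_rename comp_def)

lemma tm_val_cong: "(\<And>v. v \<in> tm_vars t \<Longrightarrow> e v = e' v) \<Longrightarrow> tm_val M e t = tm_val M e' t"
proof (induction t)
  case (Fun f ts)
  then have "map (tm_val M e) ts = map (tm_val M e') ts" by auto
  then show ?case by (simp del: map_eq_conv)
qed auto

lemma sat_atom_cong:
  assumes "\<And>v. v \<in> atom_vars \<alpha> \<Longrightarrow> e v = e' v"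
  shows "sat_atom M e \<alpha> \<longleftrightarrow> sat_atom M e' \<alpha>"
proof (cases \<alpha>)
  case (Eq s t)
  then show ?thesis using assms tm_val_cong[of s e e' M] tm_val_cong[of t e e' M] by auto
next
  case (Rel r ts)
  have "map (tm_val M e) ts = map (tm_val M e') ts"
    using assms Rel by (auto intro!: tm_val_cong)
  then show ?thesis using Rel by (simp del: map_eq_conv)
qed

lemma pp_set_iff:
  assumes "is_unary_pp L \<phi>"
  shows "x \<in> pp_set M \<phi> \<longleftrightarrow>
    (\<exists>e. e 0 = x \<and> (\<forall>i\<le>nbound \<phi>. e i \<in> carrier M) \<and> (\<forall>\<alpha>\<in>set (matrix \<phi>). sat_atom M e \<alpha>))"
    (is "?l \<longleftrightarrow> ?r")
proof
  assume ?l
  then obtain ys where ys: "length ys = nbound \<phi>" "set ys \<subseteq> carrier M" "x \<in> carrier M"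
    "\<forall>\<alpha>\<in>set (matrix \<phi>). sat_atom M (nth (x # ys)) \<alpha>"
    by (auto simp: pp_set_def)
  have "(x # ys) ! i \<in> carrier M" if "i \<le> nbound \<phi>" for i
    using that ys nth_mem[of i "x # ys"] by auto
  then show ?r using ys(4) by (intro exI[of _ "nth (x # ys)"]) auto
next
  assume ?r
  then obtain e where e: "e 0 = x" "\<forall>i\<le>nbound \<phi>. e i \<in> carrier M"
    "\<forall>\<alpha>\<in>set (matrix \<phi>). sat_atom M e \<alpha>" by auto
  define ys where "ys = map (\<lambda>i. e (Suc i)) [0..<nbound \<phi>]"
  have nth: "(x # ys) ! i = e i" if "i \<le> nbound \<phi>" for i
    using that e(1) by (cases i) (auto simp: ys_def)
  have "sat_atom M (nth (x # ys)) \<alpha>" if "\<alpha> \<in> set (matrix \<phi>)" for \<alpha>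
  proof -
    have "atom_vars \<alpha> \<subseteq> {0..nbound \<phi>}" using assms that by (auto simp: is_unary_pp_def)
    then have "sat_atom M (nth (x # ys)) \<alpha> \<longleftrightarrow> sat_atom M e \<alpha>"
      using nth by (intro sat_atom_cong) auto
    then show ?thesis using e(3) that by auto
  qed
  moreover have "length ys = nbound \<phi>" "set ys \<subseteq> carrier M" using e(2) by (auto simp: ys_def)
  moreover have "x \<in> carrier M" using e(1,2) by auto
  ultimately show ?l by (auto simp: pp_set_def)
qed

lemma wf_tm_rename: "wf_tm L (tm_rename \<rho> t) \<longleftrightarrow> wf_tm L t"
  by (induction t) auto

lemma wf_atom_rename: "wf_atom L (atom_rename \<rho> \<alpha>) \<longleftrightarrow> wf_atom L \<alpha>"
  by (cases \<alpha>) (auto simp: wf_tm_rename)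

lemma is_unary_pp_conj:
  assumes "is_unary_pp L \<phi>" "is_unary_pp L \<psi>"
  shows "is_unary_pp L (pp_conj \<phi> \<psi>)"
  using assms
  by (fastforce simp: is_unary_pp_def pp_conj_def wf_atom_rename atom.set_map subset_iff)

lemma is_unary_pp_relativize:
  assumes "is_unary_pp L \<phi>" "is_unary_pp L \<gamma>"
  shows "is_unary_pp L (relativize \<phi> \<gamma>)"
proof -
  have bd: "i * nbound \<gamma> + j \<le> nbound \<gamma> + nbound \<phi> * nbound \<gamma>"
    if "i \<le> nbound \<phi>" "j \<le> nbound \<gamma>" for i j
    using that mult_le_mono1[of i "nbound \<phi>" "nbound \<gamma>"] by linarith
  have "wf_atom L \<alpha> \<and> atom_vars \<alpha> \<subseteq> {0..nbound (relativize \<phi> \<gamma>)}"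
    if \<alpha>: "\<alpha> \<in> set (matrix (relativize \<phi> \<gamma>))" for \<alpha>
  proof -
    consider "\<alpha> \<in> set (matrix \<phi>)"
      | i \<beta> where "i \<le> nbound \<phi>" "\<beta> \<in> set (matrix \<gamma>)"
          "\<alpha> = atom_rename (\<lambda>j. if j = 0 then i else nbound \<phi> + i * nbound \<gamma> + j) \<beta>"
      using \<alpha> by (auto simp: relativize_def less_Suc_eq_le simp del: upt_Suc)
    then show ?thesis
    proof cases
      case 1
      then show ?thesis using assms(1) by (fastforce simp: is_unary_pp_def relativize_def)
    next
      case 2
      then have b: "wf_atom L \<beta>" "atom_vars \<beta> \<subseteq> {0..nbound \<gamma>}"
        using assms(2) by (auto simp: is_unary_pp_def)
      have "(if j = 0 then i else nbound \<phi> + i * nbound \<gamma> + j) \<in> {0..nbound (relativize \<phi> \<gamma>)}"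
        if "j \<in> atom_vars \<beta>" for j
        using bd[OF 2(1), of j] b(2) that 2(1) by (auto simp: relativize_def)
      then show ?thesis unfolding 2(3) wf_atom_rename atom.set_map using b(1) by blast
    qed
  qed
  then show ?thesis by (auto simp: is_unary_pp_def)
qed

lemma pp_set_conj:
  assumes "is_unary_pp L \<phi>" "is_unary_pp L \<psi>"
  shows "pp_set M (pp_conj \<phi> \<psi>) = pp_set M \<phi> \<inter> pp_set M \<psi>"
proof (intro set_eqI iffI)
  fix x
  let ?\<rho> = "\<lambda>j. if j = 0 then 0 else nbound \<phi> + j"
  {
    assume "x \<in> pp_set M (pp_conj \<phi> \<psi>)"
    then obtain e where e: "e 0 = x" "\<forall>i\<le>nbound \<phi> + nbound \<psi>. e i \<in> carrier M"
      "\<forall>\<alpha>\<in>set (matrix \<phi>). sat_atom M e \<alpha>" "\<forall>\<alpha>\<in>set (matrix \<psi>). sat_atom M (e \<circ> ?\<rho>) \<alpha>"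
      unfolding pp_set_iff[OF is_unary_pp_conj[OF assms]]
      by (auto simp: pp_conj_def sat_atom_rename ball_Un simp del: comp_apply)
    have "x \<in> pp_set M \<phi>"
      unfolding pp_set_iff[OF assms(1)] using e by (intro exI[of _ e]) auto
    moreover have "x \<in> pp_set M \<psi>"
      unfolding pp_set_iff[OF assms(2)] using e by (intro exI[of _ "e \<circ> ?\<rho>"]) auto
    ultimately show "x \<in> pp_set M \<phi> \<inter> pp_set M \<psi>" by simp
  next
    assume "x \<in> pp_set M \<phi> \<inter> pp_set M \<psi>"
    then obtain e e' where e: "e 0 = x" "\<forall>i\<le>nbound \<phi>. e i \<in> carrier M"
      "\<forall>\<alpha>\<in>set (matrix \<phi>). sat_atom M e \<alpha>"
      and e': "e' 0 = x" "\<forall>i\<le>nbound \<psi>. e' i \<in> carrier M"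
      "\<forall>\<alpha>\<in>set (matrix \<psi>). sat_atom M e' \<alpha>"
      unfolding Int_iff pp_set_iff[OF assms(1)] pp_set_iff[OF assms(2)] by auto
    define d where "d i = (if i \<le> nbound \<phi> then e i else e' (i - nbound \<phi>))" for i
    have "sat_atom M d \<alpha>" if "\<alpha> \<in> set (matrix \<phi>)" for \<alpha>
    proof -
      have v: "atom_vars \<alpha> \<subseteq> {0..nbound \<phi>}" using that assms(1) by (auto simp: is_unary_pp_def)
      have "sat_atom M d \<alpha> \<longleftrightarrow> sat_atom M e \<alpha>"
        using v by (intro sat_atom_cong) (auto simp: d_def)
      then show ?thesis using e that by auto
    qed
    moreover have "d \<circ> ?\<rho> = e'" using e(1) e'(1) by (auto simp: d_def)
    moreover have "d i \<in> carrier M" if "i \<le> nbound \<phi> + nbound \<psi>" for i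
      using that e(2) e'(2) by (auto simp: d_def)
    ultimately show "x \<in> pp_set M (pp_conj \<phi> \<psi>)"
      unfolding pp_set_iff[OF is_unary_pp_conj[OF assms]] using e(1) e'(3)
      by (intro exI[of _ d]) (auto simp: pp_conj_def sat_atom_rename d_def)
  }
qed

lemma pp_set_relativize:
  assumes "is_unary_pp L \<phi>" "is_unary_pp L \<gamma>"
  shows "pp_set M (relativize \<phi> \<gamma>) =
    {x \<in> pp_set M \<gamma>. \<exists>ys. length ys = nbound \<phi> \<and> set ys \<subseteq> pp_set M \<gamma> \<and>
       (\<forall>\<alpha>\<in>set (matrix \<phi>). sat_atom M (nth (x # ys)) \<alpha>)}"
    (is "?L = ?R")
proof (intro set_eqI iffI)
  fix x
  let ?k = "nbound \<phi>" and ?m = "nbound \<gamma>"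
  let ?\<rho> = "\<lambda>i j. if j = 0 then i else ?k + i * ?m + j"
  have mat: "(\<forall>\<alpha>\<in>set (matrix (relativize \<phi> \<gamma>)). sat_atom M e \<alpha>) \<longleftrightarrow>
      (\<forall>\<alpha>\<in>set (matrix \<phi>). sat_atom M e \<alpha>) \<and>
      (\<forall>i\<le>?k. \<forall>\<alpha>\<in>set (matrix \<gamma>). sat_atom M (e \<circ> ?\<rho> i) \<alpha>)" for e
    by (simp add: relativize_def sat_atom_rename ball_Un atLeast0LessThan lessThan_Suc_atMost
          Ball_def[of "{..?k}"] del: upt_Suc)
  have bd: "i * ?m + j \<le> ?m + ?k * ?m" if "i \<le> ?k" "j \<le> ?m" for i j
    using that mult_le_mono1[of i ?k ?m] by linarith
  {
    assume "x \<in> ?L"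
    then obtain e where e: "e 0 = x" "\<forall>i\<le>?k + Suc ?k * ?m. e i \<in> carrier M"
      "\<forall>\<alpha>\<in>set (matrix \<phi>). sat_atom M e \<alpha>"
      "\<forall>i\<le>?k. \<forall>\<alpha>\<in>set (matrix \<gamma>). sat_atom M (e \<circ> ?\<rho> i) \<alpha>"
      unfolding pp_set_iff[OF is_unary_pp_relativize[OF assms]] mat
      by (auto simp: relativize_def)
    have g: "e i \<in> pp_set M \<gamma>" if "i \<le> ?k" for i
      unfolding pp_set_iff[OF assms(2)]
    proof (intro exI[of _ "e \<circ> ?\<rho> i"] conjI allI impI)
      fix j assume "j \<le> ?m"
      then show "(e \<circ> ?\<rho> i) j \<in> carrier M" using bd[OF that, of j] that e(2) by auto
    qed (use e(4) that in auto)
    define ys where "ys = map (\<lambda>i. e (Suc i)) [0..<?k]"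
    have nth: "(x # ys) ! i = e i" if "i \<le> ?k" for i
      using that e(1) by (cases i) (auto simp: ys_def)
    have "sat_atom M (nth (x # ys)) \<alpha>" if "\<alpha> \<in> set (matrix \<phi>)" for \<alpha>
    proof -
      have "atom_vars \<alpha> \<subseteq> {0..?k}" using assms(1) that by (auto simp: is_unary_pp_def)
      then have "sat_atom M (nth (x # ys)) \<alpha> \<longleftrightarrow> sat_atom M e \<alpha>"
        using nth by (intro sat_atom_cong) auto
      then show ?thesis using e(3) that by auto
    qed
    moreover have "length ys = ?k" "set ys \<subseteq> pp_set M \<gamma>" using g by (auto simp: ys_def)
    ultimately show "x \<in> ?R" using g[of 0] e(1) by auto
  next
    assume "x \<in> ?R"
    then obtain ys where ys: "x \<in> pp_set M \<gamma>" "length ys = ?k" "set ys \<subseteq> pp_set M \<gamma>"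
      "\<forall>\<alpha>\<in>set (matrix \<phi>). sat_atom M (nth (x # ys)) \<alpha>" by auto
    have "(x # ys) ! i \<in> pp_set M \<gamma>" if "i \<le> ?k" for i
      using that ys(1-3) nth_mem[of i "x # ys"] by auto
    then have "\<forall>i. \<exists>e. i \<le> ?k \<longrightarrow> e 0 = (x # ys) ! i \<and> (\<forall>j\<le>?m. e j \<in> carrier M) \<and>
        (\<forall>\<alpha>\<in>set (matrix \<gamma>). sat_atom M e \<alpha>)"
      unfolding pp_set_iff[OF assms(2)] by auto
    then obtain E where E: "\<And>i. i \<le> ?k \<Longrightarrow> E i 0 = (x # ys) ! i"
      "\<And>i j. i \<le> ?k \<Longrightarrow> j \<le> ?m \<Longrightarrow> E i j \<in> carrier M"
      "\<And>i \<alpha>. i \<le> ?k \<Longrightarrow> \<alpha> \<in> set (matrix \<gamma>) \<Longrightarrow> sat_atom M (E i) \<alpha>"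
      by metis
    define d where "d n = (if n \<le> ?k then (x # ys) ! n
        else E ((n - ?k - 1) div ?m) (Suc ((n - ?k - 1) mod ?m)))" for n
    have dr: "(d \<circ> ?\<rho> i) j = E i j" if "i \<le> ?k" "j \<le> ?m" for i j
    proof (cases j)
      case 0
      then show ?thesis using that E(1) by (auto simp: d_def)
    next
      case (Suc l)
      then have "?k + i * ?m + j - ?k - 1 = l + i * ?m" "l < ?m" using that by auto
      then show ?thesis using Suc by (auto simp: d_def)
    qed
    have "sat_atom M d \<alpha>" if "\<alpha> \<in> set (matrix \<phi>)" for \<alpha>
    proof -
      have v: "atom_vars \<alpha> \<subseteq> {0..?k}" using that assms(1) by (auto simp: is_unary_pp_def)
      have "sat_atom M d \<alpha> \<longleftrightarrow> sat_atom M (nth (x # ys)) \<alpha>"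
        using v by (intro sat_atom_cong) (auto simp: d_def)
      then show ?thesis using ys(4) that by auto
    qed
    moreover have "sat_atom M (d \<circ> ?\<rho> i) \<alpha>" if "i \<le> ?k" "\<alpha> \<in> set (matrix \<gamma>)" for i \<alpha>
    proof -
      have v: "atom_vars \<alpha> \<subseteq> {0..?m}" using that assms(2) by (auto simp: is_unary_pp_def)
      have "sat_atom M (d \<circ> ?\<rho> i) \<alpha> \<longleftrightarrow> sat_atom M (E i) \<alpha>"
        using v dr[OF that(1)] by (intro sat_atom_cong) (auto simp del: comp_apply)
      then show ?thesis using E(3) that by auto
    qed
    moreover have "d n \<in> carrier M" if "n \<le> ?k + Suc ?k * ?m" for n
    proof (cases "n \<le> ?k")
      case True
      then show ?thesis using E(1)[of n] E(2)[of n 0] by (auto simp: d_def)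
    next
      case False
      then have *: "n - ?k - 1 < Suc ?k * ?m" using that by linarith
      then have "?m > 0" by (cases ?m) auto
      then have "(n - ?k - 1) div ?m < Suc ?k" "(n - ?k - 1) mod ?m < ?m"
        using * by (auto simp: less_mult_imp_div_less)
      then show ?thesis using False E(2) by (auto simp: d_def)
    qed
    ultimately show "x \<in> ?L"
      unfolding pp_set_iff[OF is_unary_pp_relativize[OF assms]] mat
      by (intro exI[of _ d]) (auto simp: relativize_def d_def)
  }
qed

end

(* To say that a variable v of a system takes its value in the core, adjoin to the system the
   matrices of all gamma(v), with fresh variables for the witnesses; algebraic compactness of N then
   yields solutions in the core. For U = u(U), apply this to the matrix of phi with the free
   variable replaced by an element a of U: finitely many gammas amount to a single one by (a), and
   (b) says that a satisfies phi^gamma. Since N may be copied into the type over which (a)-(c) are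
   assumed, these conditions hold for N. *)
theory Submission
  imports Defs "HOL-Library.Nat_Bijection"
begin

section \<open>Transport of structures along injections\<close>

definition copy_struct :: "('a \<Rightarrow> 'b) \<Rightarrow> ('f, 'r, 'a) struct \<Rightarrow> ('f, 'r, 'b) struct" where
  "copy_struct h M = \<lparr>carrier = h ` carrier M,
     interp_fun = (\<lambda>f xs. h (interp_fun M f (map (inv h) xs))),
     interp_rel = (\<lambda>r xs. interp_rel M r (map (inv h) xs))\<rparr>"

lemma copy_struct_simps [simp]:
  "carrier (copy_struct h M) = h ` carrier M"
  "interp_fun (copy_struct h M) f xs = h (interp_fun M f (map (inv h) xs))"
  "interp_rel (copy_struct h M) r xs = interp_rel M r (map (inv h) xs)"
  by (simp_all add: copy_struct_def)

context
  fixes h :: "'a \<Rightarrow> 'b"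
  assumes inj: "inj h"
begin

lemma tm_val_copy_struct: "tm_val (copy_struct h M) (h \<circ> e) t = h (tm_val M e t)"
proof (induction t)
  case (Fun f ts)
  then show ?case using inj by (simp cong: map_cong)
qed auto

lemma sat_atom_copy_struct: "sat_atom (copy_struct h M) (h \<circ> e) \<alpha> \<longleftrightarrow> sat_atom M e \<alpha>"
proof (cases \<alpha>)
  case (Eq s t)
  then show ?thesis using inj by (simp add: tm_val_copy_struct inj_eq del: comp_apply)
next
  case (Rel r ts)
  then show ?thesis using inj by (simp add: tm_val_copy_struct cong: map_cong)
qed

lemma pp_set_copy_struct:
  assumes "is_unary_pp L \<phi>"
  shows "pp_set (copy_struct h M) \<phi> = h ` pp_set M \<phi>"
proof (intro set_eqI iffI)
  fix x assume "x \<in> pp_set (copy_struct h M) \<phi>"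
  then obtain e where e: "e 0 = x" "\<forall>i\<le>nbound \<phi>. e i \<in> h ` carrier M"
    "\<forall>\<alpha>\<in>set (matrix \<phi>). sat_atom (copy_struct h M) e \<alpha>"
    unfolding pp_set_iff[OF assms] by auto
  \<comment> \<open>The assignment \<open>e\<close> is known to lie in the range of \<open>h\<close>
    only up to \<open>nbound \<phi>\<close>. This suffices because the atoms of the matrix mention
    no later variable.\<close>
  have h: "h (inv h (e i)) = e i" if "i \<le> nbound \<phi>" for i
    using e(2) that by (intro f_inv_into_f) auto
  have sat: "sat_atom M (inv h \<circ> e) \<alpha>" if "\<alpha> \<in> set (matrix \<phi>)" for \<alpha>
  proof -
    have "atom_vars \<alpha> \<subseteq> {0..nbound \<phi>}" using assms that by (auto simp: is_unary_pp_def)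
    then have "sat_atom (copy_struct h M) (h \<circ> (inv h \<circ> e)) \<alpha> \<longleftrightarrow> sat_atom (copy_struct h M) e \<alpha>"
      using h by (intro sat_atom_cong) auto
    then show ?thesis using e(3) that by (simp add: sat_atom_copy_struct)
  qed
  have "inv h (e 0) \<in> pp_set M \<phi>"
    unfolding pp_set_iff[OF assms]
  proof (intro exI[of _ "inv h \<circ> e"] conjI allI impI)
    fix i assume "i \<le> nbound \<phi>"
    then obtain a where "a \<in> carrier M" "e i = h a" using e(2) by auto
    then show "(inv h \<circ> e) i \<in> carrier M" using inj by simp
  qed (use sat in auto)
  then show "x \<in> h ` pp_set M \<phi>" using h[of 0] e(1) by force
next
  fix x assume "x \<in> h ` pp_set M \<phi>"
  then obtain e where e: "h (e 0) = x" "\<forall>i\<le>nbound \<phi>. e i \<in> carrier M"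
    "\<forall>\<alpha>\<in>set (matrix \<phi>). sat_atom M e \<alpha>"
    unfolding image_iff Bex_def pp_set_iff[OF assms] by auto
  then show "x \<in> pp_set (copy_struct h M) \<phi>"
    unfolding pp_set_iff[OF assms]
    by (intro exI[of _ "h \<circ> e"]) (auto simp: sat_atom_copy_struct simp del: o_apply, auto)
qed

lemma closed_under_funs_copy_struct:
  "closed_under_funs L (copy_struct h M) (h ` A) \<longleftrightarrow> closed_under_funs L M A"
proof
  assume l: "closed_under_funs L (copy_struct h M) (h ` A)"
  show "closed_under_funs L M A"
    unfolding closed_under_funs_def
  proof (intro ballI allI impI)
    fix f xs assume f: "f \<in> funs L" and xs: "length xs = fun_arity L f \<and> set xs \<subseteq> A"
    then have "interp_fun (copy_struct h M) f (map h xs) \<in> h ` A"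
      using l unfolding closed_under_funs_def by (metis image_mono length_map list.set_map)
    then show "interp_fun M f xs \<in> A"
      using inj by (auto simp: copy_struct_def inj_image_mem_iff)
  qed
next
  assume r: "closed_under_funs L M A"
  have "inv h ` h ` A = A" using inj by (simp add: image_image)
  then have "set (map (inv h) xs) \<subseteq> A" if "set xs \<subseteq> h ` A" for xs
    using image_mono[OF that, of "inv h"] by auto
  then show "closed_under_funs L (copy_struct h M) (h ` A)"
    using r by (auto simp: closed_under_funs_def copy_struct_def)
qed

lemma is_struct_copy_struct: "is_struct L (copy_struct h M) \<longleftrightarrow> is_struct L M"
  by (simp add: is_struct_def closed_under_funs_copy_struct)

lemma is_substruct_copy_struct:
  "is_substruct L (h ` A) (copy_struct h M) \<longleftrightarrow> is_substruct L A M"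
  using inj by (simp add: is_substruct_def closed_under_funs_copy_struct inj_image_subset_iff)

text \<open>Images under an injection commute with intersections; the factor
  \<open>carrier M\<close> takes care of empty \<Gamma>.\<close>

lemma pp_core_copy_struct:
  assumes "\<forall>\<gamma>\<in>\<Gamma>. is_unary_pp L \<gamma>"
  shows "pp_core \<Gamma> (copy_struct h M) = h ` pp_core \<Gamma> M"
proof -
  have "pp_set (copy_struct h M) \<gamma> = h ` pp_set M \<gamma>" if "\<gamma> \<in> \<Gamma>" for \<gamma>
    using assms that pp_set_copy_struct[of L \<gamma> M] by blast
  then have "(\<Inter>\<gamma>\<in>\<Gamma>. pp_set (copy_struct h M) \<gamma>) = (\<Inter>\<gamma>\<in>\<Gamma>. h ` pp_set M \<gamma>)" by simp
  then show ?thesis using inj by (auto simp: pp_core_def inj_image_mem_iff)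
qed

text \<open>Equivalence is assumed only for structures over one type \<open>'b\<close>. A structure
  over any type that injects into \<open>'b\<close> inherits it from its copy.\<close>

lemma logically_equivalent_pp_set:
  assumes "logically_equivalent TYPE('b) L \<phi> \<psi>" "is_unary_pp L \<phi>" "is_unary_pp L \<psi>"
    and "is_struct L (M :: ('f, 'r, 'a) struct)"
  shows "pp_set M \<phi> = pp_set M \<psi>"
proof -
  have "pp_set (copy_struct h M) \<phi> = pp_set (copy_struct h M) \<psi>"
    using assms(1,4) by (simp add: logically_equivalent_def is_struct_copy_struct)
  then show ?thesis
    using inj assms(2,3) by (simp add: pp_set_copy_struct inj_image_eq_iff)
qed

end

section \<open>Induced substructures\<close>

lemma tm_val_induced [simp]: "tm_val (induced M A) e t = tm_val M e t"
  by (induction t) (auto simp: induced_def cong: map_cong)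

lemma sat_atom_induced [simp]: "sat_atom (induced M A) e \<alpha> = sat_atom M e \<alpha>"
  by (cases \<alpha>) (auto simp: induced_def cong: map_cong simp flip: tm_val_induced[of M A])

lemma carrier_induced [simp]: "carrier (induced M A) = A"
  by (simp add: induced_def)

lemma is_struct_induced: "is_substruct L A M \<Longrightarrow> is_struct L (induced M A)"
  by (auto simp: is_struct_def is_substruct_def closed_under_funs_def induced_def)

lemma algebraically_compactD:
  fixes N :: "('f, 'r, 'a) struct" and \<Phi> :: "('f, 'r, 'v + 'a) atom set"
  assumes "algebraically_compact TYPE('v) L N"
    and "\<And>\<alpha>. \<alpha> \<in> \<Phi> \<Longrightarrow> wf_atom L \<alpha> \<and> atom_vars \<alpha> \<subseteq> range Inl \<union> Inr ` carrier N"
    and "\<And>\<Phi>\<^sub>0. \<Phi>\<^sub>0 \<subseteq> \<Phi> \<Longrightarrow> finite \<Phi>\<^sub>0 \<Longrightarrow> satisfiable N \<Phi>\<^sub>0"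
  shows "satisfiable N \<Phi>"
  using assms by (simp add: algebraically_compact_def)

section \<open>Solving systems inside the core\<close>

text \<open>The triple \<open>(v, \<gamma>, j)\<close> names the \<open>j\<close>-th variable of the
  copy of \<gamma> attached to \<open>v\<close>, and \<open>h\<close> finds room for these names in
  \<open>'w\<close>. A finite part of the enlarged system involves finitely many \<gamma>, so
  \<open>fin\<close> asks only for solutions in the core of a finite
  \<open>\<Gamma>\<^sub>0\<close>.\<close>

lemma satisfiable_in_core:
  fixes N :: "('f, 'r, 'a) struct" and \<Phi> :: "('f, 'r, 'v + 'a) atom set"
    and h :: "'v \<times> ('f, 'r) pp \<times> nat \<Rightarrow> 'w"
  assumes compact: "algebraically_compact TYPE('w) L N"
    and h: "inj h"
    and unary: "\<forall>\<gamma>\<in>\<Gamma>. is_unary_pp L \<gamma>"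
    and wf: "\<forall>\<alpha>\<in>\<Phi>. wf_atom L \<alpha> \<and> atom_vars \<alpha> \<subseteq> range Inl \<union> Inr ` carrier N"
    and fin: "\<And>\<Phi>\<^sub>0 \<Gamma>\<^sub>0. \<Phi>\<^sub>0 \<subseteq> \<Phi> \<Longrightarrow> finite \<Phi>\<^sub>0 \<Longrightarrow> \<Gamma>\<^sub>0 \<subseteq> \<Gamma> \<Longrightarrow> finite \<Gamma>\<^sub>0 \<Longrightarrow>
      \<exists>e. range e \<subseteq> pp_core \<Gamma>\<^sub>0 N \<and> (\<forall>\<alpha>\<in>\<Phi>\<^sub>0. sat_atom N (case_sum e id) \<alpha>)"
  shows "\<exists>e. range e \<subseteq> pp_core \<Gamma> N \<and> (\<forall>\<alpha>\<in>\<Phi>. sat_atom N (case_sum e id) \<alpha>)"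
proof -
  \<comment> \<open>All copies attached to \<open>v\<close> share \<open>x v\<close> as their free
    variable. The tag \<open>PP 0 []\<close> is arbitrary: witnesses have
    \<open>j \<noteq> 0\<close>, hence never collide with \<open>x v\<close>.\<close>
  define x where "x v = h (v, PP 0 [], 0)" for v
  define y where "y v \<gamma> j = (if j = 0 then x v else h (v, \<gamma>, j))" for v \<gamma> j
  \<comment> \<open>\<open>F\<close> translates the given atoms and keeps their parameters;
    \<open>G\<close> sends a triple in \<open>S\<close> to one conjunct of the matrix of \<gamma>
    stated for \<open>v\<close>.\<close>
  define F where "F = (atom_rename (map_sum x id) ::
    ('f, 'r, 'v + 'a) atom \<Rightarrow> ('f, 'r, 'w + 'a) atom)"
  define G where "G = (\<lambda>(v, \<gamma> :: ('f, 'r) pp, \<beta> :: ('f, 'r, nat) atom). atom_rename (\<lambda>j. Inl (y v \<gamma> j) :: 'w + 'a) \<beta>)"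
  define S where "S = {(v :: 'v, \<gamma>, \<beta>). \<gamma> \<in> \<Gamma> \<and> \<beta> \<in> set (matrix \<gamma>)}"
  have F: "sat_atom N (case_sum e id) (F \<alpha>) \<longleftrightarrow> sat_atom N (case_sum (e \<circ> x) id) \<alpha>" 
    for e and \<alpha> :: "('f, 'r, 'v + 'a) atom"
    by (simp add: F_def sat_atom_rename case_sum_o_map_sum)
  have G: "sat_atom N (case_sum e id) (G (v, \<gamma>, \<beta>)) \<longleftrightarrow> sat_atom N (e \<circ> y v \<gamma>) \<beta>"
    for e v \<gamma> and \<beta> :: "('f, 'r, nat) atom"
    by (simp add: G_def sat_atom_rename comp_def)
  have "satisfiable N \<Psi>\<^sub>0" if sub: "\<Psi>\<^sub>0 \<subseteq> F ` \<Phi> \<union> G ` S" and "finite \<Psi>\<^sub>0" for \<Psi>\<^sub>0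
  proof -
    have "\<Psi>\<^sub>0 \<inter> F ` \<Phi> \<subseteq> F ` \<Phi>" "\<Psi>\<^sub>0 \<inter> G ` S \<subseteq> G ` S" "finite (\<Psi>\<^sub>0 \<inter> F ` \<Phi>)" "finite (\<Psi>\<^sub>0 \<inter> G ` S)"
      using \<open>finite \<Psi>\<^sub>0\<close> by auto
    then obtain \<Phi>\<^sub>0 S\<^sub>0 where \<Phi>\<^sub>0: "\<Phi>\<^sub>0 \<subseteq> \<Phi>" "finite \<Phi>\<^sub>0" "\<Psi>\<^sub>0 \<inter> F ` \<Phi> = F ` \<Phi>\<^sub>0"
      and S\<^sub>0: "S\<^sub>0 \<subseteq> S" "finite S\<^sub>0" "\<Psi>\<^sub>0 \<inter> G ` S = G ` S\<^sub>0"
      using finite_subset_image by meson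
    \<comment> \<open>These are the formulas from which the chosen finite set of adjoined atoms
      stems.\<close>
    define \<Gamma>\<^sub>0 where "\<Gamma>\<^sub>0 = (\<lambda>(v, \<gamma>, \<beta>). \<gamma>) ` S\<^sub>0"
    have "\<Gamma>\<^sub>0 \<subseteq> \<Gamma>" "finite \<Gamma>\<^sub>0" using S\<^sub>0 by (auto simp: \<Gamma>\<^sub>0_def S_def)
    then obtain e where e: "range e \<subseteq> pp_core \<Gamma>\<^sub>0 N" "\<forall>\<alpha>\<in>\<Phi>\<^sub>0. sat_atom N (case_sum e id) \<alpha>"
      using fin[OF \<Phi>\<^sub>0(1,2)] by blast
    \<comment> \<open>Every variable of the enlarged system needs a value in the carrier, including
      those outside the finite part. Hence \<open>d\<close> is constant for \<gamma> outside
      \<open>\<Gamma>\<^sub>0\<close>, and otherwise frozen beyond \<open>nbound \<gamma>\<close>,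
      where no atom of the matrix looks.\<close>
    have "\<exists>d. d 0 = e v \<and> range d \<subseteq> carrier N \<and>
      (\<gamma> \<in> \<Gamma>\<^sub>0 \<longrightarrow> (\<forall>\<beta>\<in>set (matrix \<gamma>). sat_atom N d \<beta>))" for v \<gamma>
    proof (cases "\<gamma> \<in> \<Gamma>\<^sub>0")
      case True
      then have un: "is_unary_pp L \<gamma>" using unary \<open>\<Gamma>\<^sub>0 \<subseteq> \<Gamma>\<close> by auto
      have "e v \<in> pp_set N \<gamma>" using e(1) True by (auto simp: pp_core_def)
      then obtain d where d: "d 0 = e v" "\<forall>i\<le>nbound \<gamma>. d i \<in> carrier N"
        "\<forall>\<beta>\<in>set (matrix \<gamma>). sat_atom N d \<beta>"
        unfolding pp_set_iff[OF un] by auto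
      have "sat_atom N (\<lambda>i. d (min i (nbound \<gamma>))) \<beta>" if "\<beta> \<in> set (matrix \<gamma>)" for \<beta>
      proof -
        have "atom_vars \<beta> \<subseteq> {0..nbound \<gamma>}" using un that by (auto simp: is_unary_pp_def)
        then have "sat_atom N (\<lambda>i. d (min i (nbound \<gamma>))) \<beta> \<longleftrightarrow> sat_atom N d \<beta>"
          by (intro sat_atom_cong) (auto simp: min_def)
        then show ?thesis using d(3) that by auto
      qed
      then show ?thesis using d by (intro exI[of _ "\<lambda>i. d (min i (nbound \<gamma>))"]) auto
    next
      case False
      then show ?thesis using e(1) by (intro exI[of _ "\<lambda>_. e v"]) (auto simp: pp_core_def)
    qed
    then obtain d where d: "\<And>v \<gamma>. d v \<gamma> 0 = e v" "\<And>v \<gamma>. range (d v \<gamma>) \<subseteq> carrier N"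
      "\<And>v \<gamma> \<beta>. \<gamma> \<in> \<Gamma>\<^sub>0 \<Longrightarrow> \<beta> \<in> set (matrix \<gamma>) \<Longrightarrow> sat_atom N (d v \<gamma>) \<beta>"
      by metis
    \<comment> \<open>A variable is decoded to its triple and given the corresponding witness. Since
      \<open>d v \<gamma> 0 = e v\<close> for every \<gamma>, the arbitrary tag in \<open>x\<close>
      does no harm.\<close>
    define e' where "e' = (\<lambda>(v, \<gamma>, j). d v \<gamma> j) \<circ> inv h"
    have x: "e' \<circ> x = e" using h d(1) by (auto simp: e'_def x_def)
    have y: "e' \<circ> y v \<gamma> = d v \<gamma>" for v \<gamma>
      using h d(1) by (auto simp: e'_def y_def x_def)
    have "range e' \<subseteq> carrier N" using d(2) by (auto simp: e'_def image_subset_iff split: prod.split)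
    moreover have "sat_atom N (case_sum e' id) \<alpha>" if \<alpha>: "\<alpha> \<in> \<Psi>\<^sub>0" for \<alpha>
    proof -
      have "\<alpha> \<in> F ` \<Phi>\<^sub>0 \<union> G ` S\<^sub>0" using \<alpha> sub \<Phi>\<^sub>0(3) S\<^sub>0(3) by blast
      then show ?thesis
      proof
        assume "\<alpha> \<in> F ` \<Phi>\<^sub>0"
        then show ?thesis using e(2) by (auto simp: F x)
      next
        assume "\<alpha> \<in> G ` S\<^sub>0"
        then obtain v \<gamma> \<beta> where s: "\<alpha> = G (v, \<gamma>, \<beta>)" "(v, \<gamma>, \<beta>) \<in> S\<^sub>0" by auto
        then have "\<gamma> \<in> \<Gamma>\<^sub>0" "\<beta> \<in> set (matrix \<gamma>)" using S\<^sub>0(1) by (force simp: \<Gamma>\<^sub>0_def S_def)+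
        then show ?thesis using d(3) by (simp add: s(1) G y)
      qed
    qed
    ultimately show ?thesis unfolding satisfiable_def by blast
  qed
  moreover have "wf_atom L \<alpha> \<and> atom_vars \<alpha> \<subseteq> range Inl \<union> Inr ` carrier N"
    if "\<alpha> \<in> F ` \<Phi> \<union> G ` S" for \<alpha>
    using that
  proof
    assume "\<alpha> \<in> F ` \<Phi>"
    then show ?thesis using wf by (fastforce simp: F_def wf_atom_rename atom.set_map)
  next
    assume "\<alpha> \<in> G ` S"
    then show ?thesis using unary
      by (auto simp: G_def S_def wf_atom_rename atom.set_map is_unary_pp_def)
  qed
  ultimately have "satisfiable N (F ` \<Phi> \<union> G ` S)"
    using algebraically_compactD[OF compact, of "F ` \<Phi> \<union> G ` S"] by blast
  then obtain e where e: "range e \<subseteq> carrier N"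
    "\<forall>\<alpha>\<in>F ` \<Phi> \<union> G ` S. sat_atom N (case_sum e id) \<alpha>"
    unfolding satisfiable_def by blast
  \<comment> \<open>The values of the solution at the variables \<open>y v \<gamma> j\<close> are
    the witnesses for \<gamma>.\<close>
  have "e (x v) \<in> pp_set N \<gamma>" if "\<gamma> \<in> \<Gamma>" for v \<gamma>
  proof -
    have un: "is_unary_pp L \<gamma>" using unary that by auto
    have "sat_atom N (e \<circ> y v \<gamma>) \<beta>" if "\<beta> \<in> set (matrix \<gamma>)" for \<beta>
    proof -
      have "G (v, \<gamma>, \<beta>) \<in> G ` S" using that \<open>\<gamma> \<in> \<Gamma>\<close> by (auto simp: S_def)
      then show ?thesis using e(2) G by blast
    qed
    then show ?thesis
      unfolding pp_set_iff[OF un] using e(1)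
      by (intro exI[of _ "e \<circ> y v \<gamma>"]) (auto simp: y_def image_subset_iff)
  qed
  then have "range (e \<circ> x) \<subseteq> pp_core \<Gamma> N" using e(1) by (auto simp: pp_core_def)
  moreover have "\<forall>\<alpha>\<in>\<Phi>. sat_atom N (case_sum (e \<circ> x) id) \<alpha>" using e(2) by (auto simp flip: F)
  ultimately show ?thesis by blast
qed

text \<open>A solution of a finite subsystem in the core of \<Gamma> also lies in the core of each
  subset \<open>\<Gamma>\<^sub>0\<close>. So finite satisfiability in the core is already what
  \<open>satisfiable_in_core\<close> requires.\<close>

lemma algebraically_compact_core:
  fixes N :: "('f, 'r, 'a) struct" and h :: "'v \<times> ('f, 'r) pp \<times> nat \<Rightarrow> 'w"
  assumes compact: "algebraically_compact TYPE('w) L N"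
    and h: "inj h"
    and unary: "\<forall>\<gamma>\<in>\<Gamma>. is_unary_pp L \<gamma>"
    and sub: "is_substruct L (pp_core \<Gamma> N) N"
  shows "algebraically_compact TYPE('v) L (induced N (pp_core \<Gamma> N))"
  unfolding algebraically_compact_def
proof (intro conjI allI impI)
  show "is_struct L (induced N (pp_core \<Gamma> N))" using sub by (rule is_struct_induced)
next
  let ?U = "pp_core \<Gamma> N"
  fix \<Phi> :: "('f, 'r, 'v + 'a) atom set"
  assume wf: "\<forall>\<alpha>\<in>\<Phi>. wf_atom L \<alpha> \<and> atom_vars \<alpha> \<subseteq> range Inl \<union> Inr ` carrier (induced N ?U)"
    and fin: "\<forall>\<Phi>\<^sub>0\<subseteq>\<Phi>. finite \<Phi>\<^sub>0 \<longrightarrow> satisfiable (induced N ?U) \<Phi>\<^sub>0"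
  have "\<exists>e. range e \<subseteq> ?U \<and> (\<forall>\<alpha>\<in>\<Phi>. sat_atom N (case_sum e id) \<alpha>)"
  proof (rule satisfiable_in_core[OF compact h unary])
    show "\<forall>\<alpha>\<in>\<Phi>. wf_atom L \<alpha> \<and> atom_vars \<alpha> \<subseteq> range Inl \<union> Inr ` carrier N"
    proof
      fix \<alpha> assume "\<alpha> \<in> \<Phi>"
      then have "wf_atom L \<alpha>" "atom_vars \<alpha> \<subseteq> range Inl \<union> Inr ` ?U" using wf by auto
      moreover have "Inr ` ?U \<subseteq> (Inr ` carrier N :: ('v + 'a) set)" by (auto simp: pp_core_def)
      ultimately show "wf_atom L \<alpha> \<and> atom_vars \<alpha> \<subseteq> range Inl \<union> Inr ` carrier N" by blast
    qed
  next
    fix \<Phi>\<^sub>0 \<Gamma>\<^sub>0 assume *: "\<Phi>\<^sub>0 \<subseteq> \<Phi>" "finite \<Phi>\<^sub>0" "\<Gamma>\<^sub>0 \<subseteq> \<Gamma>"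
    have "satisfiable (induced N ?U) \<Phi>\<^sub>0" using fin *(1,2) by simp
    then obtain e where "range e \<subseteq> ?U" "\<forall>\<alpha>\<in>\<Phi>\<^sub>0. sat_atom N (case_sum e id) \<alpha>"
      by (auto simp: satisfiable_def)
    moreover have "?U \<subseteq> pp_core \<Gamma>\<^sub>0 N" using *(3) by (auto simp: pp_core_def)
    ultimately show "\<exists>e. range e \<subseteq> pp_core \<Gamma>\<^sub>0 N \<and> (\<forall>\<alpha>\<in>\<Phi>\<^sub>0. sat_atom N (case_sum e id) \<alpha>)"
      by (meson subset_trans)
  qed
  then show "satisfiable (induced N ?U) \<Phi>" by (simp add: satisfiable_def)
qed

section \<open>The core of the core\<close>

text \<open>Closure under conjunction folds finitely many formulas into one member of \<Gamma>;
  \<phi> serves as the start when \<open>\<Gamma>\<^sub>0\<close> is empty.\<close>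

lemma finite_pp_core_subset:
  assumes "finite \<Gamma>\<^sub>0" "\<Gamma>\<^sub>0 \<subseteq> \<Gamma>" "\<phi> \<in> \<Gamma>"
    and conj: "\<And>\<phi> \<gamma>. \<phi> \<in> \<Gamma> \<Longrightarrow> \<gamma> \<in> \<Gamma> \<Longrightarrow> \<exists>\<chi>\<in>\<Gamma>. pp_set N \<chi> = pp_set N \<phi> \<inter> pp_set N \<gamma>"
  shows "\<exists>\<gamma>\<in>\<Gamma>. pp_set N \<gamma> \<subseteq> pp_core \<Gamma>\<^sub>0 N"
  using assms(1,2)
proof (induction \<Gamma>\<^sub>0)
  case empty
  have "pp_set N \<phi> \<subseteq> pp_core {} N" by (auto simp: pp_core_def pp_set_def)
  then show ?case using assms(3) by blast
next
  case (insert \<delta> \<Gamma>\<^sub>0)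
  then obtain \<gamma> where \<gamma>: "\<gamma> \<in> \<Gamma>" "pp_set N \<gamma> \<subseteq> pp_core \<Gamma>\<^sub>0 N" by auto
  then obtain \<chi> where "\<chi> \<in> \<Gamma>" "pp_set N \<chi> = pp_set N \<gamma> \<inter> pp_set N \<delta>"
    using conj[of \<gamma> \<delta>] insert.prems by auto
  moreover have "pp_set N \<gamma> \<inter> pp_set N \<delta> \<subseteq> pp_core (insert \<delta> \<Gamma>\<^sub>0) N"
    using \<gamma>(2) by (auto simp: pp_core_def)
  ultimately show ?case by auto
qed

text \<open>An element of the core satisfies \<phi> in \<open>N\<close>, but its witnesses may lie
  outside the core. They are found anew by treating the bound variables of \<phi> as unknowns of a
  system.\<close>

lemma core_subset_pp_set_core:
  fixes N :: "('f, 'r, 'a) struct" and h :: "nat \<times> ('f, 'r) pp \<times> nat \<Rightarrow> 'w"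
  assumes compact: "algebraically_compact TYPE('w) L N"
    and h: "inj h"
    and unary: "\<forall>\<gamma>\<in>\<Gamma>. is_unary_pp L \<gamma>"
    and conj: "\<And>\<phi> \<gamma>. \<phi> \<in> \<Gamma> \<Longrightarrow> \<gamma> \<in> \<Gamma> \<Longrightarrow> \<exists>\<chi>\<in>\<Gamma>. pp_set N \<chi> = pp_set N \<phi> \<inter> pp_set N \<gamma>"
    and rel: "\<And>\<phi> \<gamma>. \<phi> \<in> \<Gamma> \<Longrightarrow> \<gamma> \<in> \<Gamma> \<Longrightarrow> \<exists>\<chi>\<in>\<Gamma>. pp_set N \<chi> = pp_set N (relativize \<phi> \<gamma>)"
    and \<phi>: "\<phi> \<in> \<Gamma>"
  shows "pp_core \<Gamma> N \<subseteq> pp_set (induced N (pp_core \<Gamma> N)) \<phi>"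
proof
  fix a assume a: "a \<in> pp_core \<Gamma> N"
  \<comment> \<open>Variable \<open>0\<close> becomes the parameter \<open>a\<close>, so the unknown
    \<open>Inl 0\<close> occurs nowhere in the system and its value may be overwritten by
    \<open>a\<close>.\<close>
  define \<rho> where "\<rho> i = (if i = 0 then Inr a else Inl i)" for i :: nat
  have un: "is_unary_pp L \<phi>" using unary \<phi> by auto
  have \<rho>: "case_sum e id \<circ> \<rho> = e(0 := a)" for e by (auto simp: \<rho>_def)
  have "\<exists>e. range e \<subseteq> pp_core \<Gamma> N \<and>
    (\<forall>\<alpha>\<in>atom_rename \<rho> ` set (matrix \<phi>). sat_atom N (case_sum e id) \<alpha>)"
  proof (rule satisfiable_in_core[OF compact h unary])
    have "atom_vars (atom_rename \<rho> \<alpha>) \<subseteq> range Inl \<union> Inr ` carrier N" for \<alpha> :: "('f, 'r, nat) atom"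
      using a by (auto simp: \<rho>_def atom.set_map pp_core_def)
    then show "\<forall>\<alpha>\<in>atom_rename \<rho> ` set (matrix \<phi>).
        wf_atom L \<alpha> \<and> atom_vars \<alpha> \<subseteq> range Inl \<union> Inr ` carrier N"
      using un by (auto simp: is_unary_pp_def wf_atom_rename)
  next
    fix \<Phi>\<^sub>0 \<Gamma>\<^sub>0
    assume *: "\<Phi>\<^sub>0 \<subseteq> atom_rename \<rho> ` set (matrix \<phi>)" "\<Gamma>\<^sub>0 \<subseteq> \<Gamma>" "finite \<Gamma>\<^sub>0"
    obtain \<gamma> where \<gamma>: "\<gamma> \<in> \<Gamma>" "pp_set N \<gamma> \<subseteq> pp_core \<Gamma>\<^sub>0 N"
      using finite_pp_core_subset[OF *(3,2) \<phi> conj] by blast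
    \<comment> \<open>Some member of \<Gamma> defines the same set in \<open>N\<close> as
      \<open>relativize \<phi> \<gamma>\<close>, and \<open>a\<close> satisfies all of \<Gamma>.
      This confines the witnesses to \<open>pp_set N \<gamma>\<close>.\<close>
    have "a \<in> pp_set N (relativize \<phi> \<gamma>)"
      using a rel[OF \<phi> \<gamma>(1)] by (auto simp: pp_core_def)
    then obtain ys where ys: "length ys = nbound \<phi>" "set ys \<subseteq> pp_set N \<gamma>" "a \<in> pp_set N \<gamma>"
      "\<forall>\<alpha>\<in>set (matrix \<phi>). sat_atom N (nth (a # ys)) \<alpha>"
      using pp_set_relativize[OF un, of \<gamma> N] unary \<gamma>(1) by auto
    \<comment> \<open>The default \<open>a\<close> keeps the unknowns beyond
      \<open>nbound \<phi>\<close> inside \<open>pp_set N \<gamma>\<close> as well.\<close>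
    define e where "e i = (if i \<le> nbound \<phi> then (a # ys) ! i else a)" for i
    have "e i \<in> pp_set N \<gamma>" for i
      using ys(1-3) nth_mem[of i "a # ys"] by (auto simp: e_def)
    then have "range e \<subseteq> pp_core \<Gamma>\<^sub>0 N" using \<gamma>(2) by auto
    moreover have "sat_atom N (case_sum e id) (atom_rename \<rho> \<alpha>)" if "\<alpha> \<in> set (matrix \<phi>)" for \<alpha>
    proof -
      have "atom_vars \<alpha> \<subseteq> {0..nbound \<phi>}" using un that by (auto simp: is_unary_pp_def)
      then have "sat_atom N (e(0 := a)) \<alpha> \<longleftrightarrow> sat_atom N (nth (a # ys)) \<alpha>"
        by (intro sat_atom_cong) (auto simp: e_def)
      then show ?thesis using ys(4) that by (simp add: sat_atom_rename \<rho>)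
    qed
    ultimately show "\<exists>e. range e \<subseteq> pp_core \<Gamma>\<^sub>0 N \<and> (\<forall>\<alpha>\<in>\<Phi>\<^sub>0. sat_atom N (case_sum e id) \<alpha>)"
      using *(1) by blast
  qed
  then obtain e where e: "range e \<subseteq> pp_core \<Gamma> N" "\<forall>\<alpha>\<in>set (matrix \<phi>). sat_atom N (e(0 := a)) \<alpha>"
    by (auto simp: sat_atom_rename \<rho>)
  then show "a \<in> pp_set (induced N (pp_core \<Gamma> N)) \<phi>"
    unfolding pp_set_iff[OF un] using a
    by (intro exI[of _ "e(0 := a)"]) (auto simp: image_subset_iff)
qed

section \<open>Descent of the closure conditions to \<open>N\<close>, and both conclusions\<close>

theorem theorem4:
  fixes L :: "('f, 'r) lang"
    and \<Gamma> :: "('f, 'r) pp set"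
    and N :: "('f, 'r, 'a) struct"
    and U :: "'a set"
  assumes "\<forall>\<gamma>\<in>\<Gamma>. is_unary_pp L \<gamma>"
    and "\<forall>\<phi>\<in>\<Gamma>. \<forall>\<gamma>\<in>\<Gamma>. \<exists>\<chi>\<in>\<Gamma>.
      logically_equivalent TYPE(('f, 'r, 'a) elts) L \<chi> (pp_conj \<phi> \<gamma>)"
    and "\<forall>\<phi>\<in>\<Gamma>. \<forall>\<gamma>\<in>\<Gamma>. \<exists>\<chi>\<in>\<Gamma>.
      logically_equivalent TYPE(('f, 'r, 'a) elts) L \<chi> (relativize \<phi> \<gamma>)"
    and "\<forall>M :: ('f, 'r, ('f, 'r, 'a) elts) struct.
      is_struct L M \<longrightarrow> is_substruct L (pp_core \<Gamma> M) M"
    and "algebraically_compact TYPE(('f, 'r, 'a, 'v) many_vars) L N"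
    and "U = pp_core \<Gamma> N"
  shows "algebraically_compact TYPE('v) L (induced N U) \<and> U = pp_core \<Gamma> (induced N U)"
proof -
  note unary = assms(1) and compact = assms(5)
  have N: "is_struct L N" using compact by (simp add: algebraically_compact_def)
  \<comment> \<open>Along \<open>Inl\<close> the hypotheses on structures over \<open>elts\<close>
    reach \<open>N\<close>.\<close>
  have inl: "inj (Inl :: 'a \<Rightarrow> ('f, 'r, 'a) elts)" by simp
  have conj: "\<exists>\<chi>\<in>\<Gamma>. pp_set N \<chi> = pp_set N \<phi> \<inter> pp_set N \<gamma>" if "\<phi> \<in> \<Gamma>" "\<gamma> \<in> \<Gamma>" for \<phi> \<gamma>
  proof -
    have un: "is_unary_pp L \<phi>" "is_unary_pp L \<gamma>" using unary that by auto
    obtain \<chi> where \<chi>: "\<chi> \<in> \<Gamma>" "logically_equivalent TYPE(('f, 'r, 'a) elts) L \<chi> (pp_conj \<phi> \<gamma>)"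
      using assms(2) \<open>\<phi> \<in> \<Gamma>\<close> \<open>\<gamma> \<in> \<Gamma>\<close> by blast
    then have "pp_set N \<chi> = pp_set N (pp_conj \<phi> \<gamma>)"
      using logically_equivalent_pp_set[OF inl _ _ is_unary_pp_conj[OF un] N] unary by blast
    then show ?thesis using \<chi>(1) pp_set_conj[OF un, of N] by blast
  qed
  have rel: "\<exists>\<chi>\<in>\<Gamma>. pp_set N \<chi> = pp_set N (relativize \<phi> \<gamma>)" if "\<phi> \<in> \<Gamma>" "\<gamma> \<in> \<Gamma>" for \<phi> \<gamma>
  proof -
    have un: "is_unary_pp L \<phi>" "is_unary_pp L \<gamma>" using unary that by auto
    obtain \<chi> where "\<chi> \<in> \<Gamma>" "logically_equivalent TYPE(('f, 'r, 'a) elts) L \<chi> (relativize \<phi> \<gamma>)"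
      using assms(3) \<open>\<phi> \<in> \<Gamma>\<close> \<open>\<gamma> \<in> \<Gamma>\<close> by blast
    then show ?thesis
      using logically_equivalent_pp_set[OF inl _ _ is_unary_pp_relativize[OF un] N] unary by blast
  qed
  \<comment> \<open>Condition (c) is applied to the copy of \<open>N\<close> and then pulled back
    along \<open>Inl\<close>.\<close>
  have "is_struct L (copy_struct (Inl :: 'a \<Rightarrow> ('f, 'r, 'a) elts) N)"
    using N by (simp add: is_struct_copy_struct[OF inl])
  then have sub: "is_substruct L (pp_core \<Gamma> N) N"
    using assms(4) is_substruct_copy_struct[OF inl] pp_core_copy_struct[OF inl unary] by metis
  have "inj (\<lambda>(v, \<gamma>, j). (Inl v, \<gamma>, j) :: ('f, 'r, 'a, 'v) many_vars)"
    by (auto simp: inj_def)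
  then have "algebraically_compact TYPE('v) L (induced N U)"
    unfolding assms(6) by (rule algebraically_compact_core[OF compact _ unary sub])
  \<comment> \<open>Here the unknowns are natural numbers, which need not embed into
    \<open>'v + 'a\<close>. Both numbers are therefore packed into the last component, and the first
    is a fixed dummy.\<close>
  moreover have "inj (\<lambda>(i, \<gamma>, j). (undefined, \<gamma>, prod_encode (i, j)) :: ('f, 'r, 'a, 'v) many_vars)"
    by (auto simp: inj_def prod_encode_eq)
  then have "U \<subseteq> pp_set (induced N U) \<phi>" if "\<phi> \<in> \<Gamma>" for \<phi>
    unfolding assms(6) using core_subset_pp_set_core[OF compact _ unary conj rel that] by blast
  \<comment> \<open>The reverse inclusion holds because \<open>U\<close> is the carrier of the
    induced structure.\<close>
  then have "U = pp_core \<Gamma> (induced N U)"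
    by (auto simp: pp_core_def)
  ultimately show ?thesis by simp
qed

end
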